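(* Let $U, V_1,\dots,V_p$, $A$, $R_i$, $R_i^*$, $f$, $u^0$, $\bm V$, $\bm B,\bm B_1,\bm B_2$ be as in the context, with in particular $U=R_1^*V_1\oplus\dots\oplus R_p^*V_p$, $R_iR_i^*=I_i$, $R_iR_j^*=0$ for $i\ne j$, and $\bm B=\bm B_1+\bm B_2$, $\bm B_1^*=\bm B_2$. Let $\sigma\ge\frac12$ be a constant. Then the factorized scheme $$(\bm I+\tau\sigma\bm B_1)(\bm I+\tau\sigma\bm B_2)\frac{\bm w^{n+1}-\bm w^n}{\tau}+\bm B\bm w^n=\bm f^n,\quad n=0,\dots,N-1,\qquad \bm w^0=\bm v^0,$$ is unconditionally stable; that is, for every time step $\tau>0$ (with $N\tau=T$), the approximate solution $y^n=\sum_{i=1}^pR_i^*w_i^n$ satisfies for all $n=0,\dots,N-1$ $$\|y^{n+1}\|_A^2\le\|u^0\|_A^2+\frac12\sum_{k=0}^n\tau\|f^k\|^2 .$$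
   Context: $U$ is a finite-dimensional real Hilbert space with scalar product $(\cdot,\cdot)$ and norm $\|\cdot\|$. $A:U\to U$ is a linear operator, independent of $t$, self-adjoint and positive definite ($A=A^*>0$); $\|u\|_A=(Au,u)^{1/2}$. The problem being approximated is the Cauchy problem $\frac{du}{dt}+Au=f(t)$, $0<t\le T$, $u(0)=u^0\in U$, with given $f:[0,T]\to U$. $V_1,\dots,V_p$ ($p\ge1$) are finite-dimensional real Hilbert spaces with scalar products $(\cdot,\cdot)_i$ and identity operators $I_i$; $R_i:U\to V_i$ are linear operators with adjoints $R_i^*:V_i\to U$. It is assumed that $U$ is the direct sum $U=R_1^*V_1\oplus\dots\oplus R_p^*V_p$, with $u=\sum_iR_i^*v_i$, $v_i=R_iu$, for each $u\in U$, so that $R_iR_i^*=I_i$ and $R_iR_j^*=0$ for $i\neq j$. $\bm V=V_1\oplus\dots\oplus V_p$ with scalar product $(\bm v,\bm z)=\sum_{i=1}^p(v_i,z_i)_i$ for $\bm v=\{v_1,\dots,v_p\}$, $\bm z=\{z_1,\dots,z_p\}$; $\bm I$ is the identity on $\bm V$. On $\bm V$ define $\bm B=\{R_iAR_j^*\}_{i,j=1}^p$ and its triangular parts: $\bm B_1$ is the block lower triangular operator matrix with entries $(\bm B_1)_{ij}=R_iAR_j^*$ for $i>j$, $(\bm B_1)_{ii}=\frac12R_iAR_i^*$, $(\bm B_1)_{ij}=0$ for $i<j$; $\bm B_2$ is the block upper triangular operator matrix with entries $(\bm B_2)_{ij}=R_iAR_j^*$ for $i<j$, $(\bm B_2)_{ii}=\frac12R_iAR_i^*$,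 $(\bm B_2)_{ij}=0$ for $i>j$. Thus $\bm B=\bm B_1+\bm B_2$ and $\bm B_1^*=\bm B_2$. Time grid: $t^n=n\tau$, $n=0,\dots,N$, $N\tau=T$; $f^n=f(t^n)$; $\bm f^n=\{R_1f^n,\dots,R_pf^n\}\in\bm V$; $\bm v^0=\{R_1u^0,\dots,R_pu^0\}$. Components of $\bm w^n\in\bm V$ are denoted $w_i^n$. *)

theory Defs
  imports "HOL-Analysis.Analysis"
begin

(* The spaces V_1, ..., V_p are modelled as finite-dimensional subspaces V i of one real inner
   product space, indexed by a finite linearly ordered type 'p with p = CARD('p). This loses no
   generality: any p Hilbert spaces embed isometrically in their orthogonal sum. The inner
   product of the type ('v, 'p) vec is the sum of the componentwise inner products.

   The operators R i have their range in V i, so on V i the library adjoint of R i as a map into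
   the ambient space is the adjoint R_i^* : V_i -> U. It is genuinely an adjoint whenever U is
   finite-dimensional (adjoint_fin_dim). Requiring a finite spanning set instead of the class
   euclidean_space keeps zero-dimensional U. *)

definition fin_dim_subspace :: "'a::real_vector set \<Rightarrow> bool" where
  "fin_dim_subspace S \<longleftrightarrow> (\<exists>C. finite C \<and> span C = S)"

definition self_adjoint_pos_def :: "('u::real_inner \<Rightarrow> 'u) \<Rightarrow> bool" where
  "self_adjoint_pos_def A \<longleftrightarrow> linear A \<and> adjoint A = A \<and> (\<forall>u. u \<noteq> 0 \<longrightarrow> A u \<bullet> u > 0)"

definition energy_norm :: "('u::real_inner \<Rightarrow> 'u) \<Rightarrow> 'u \<Rightarrow> real" where
  "energy_norm A u = sqrt (A u \<bullet> u)"

definition is_direct_sum :: "('p::finite \<Rightarrow> 'u::real_vector set) \<Rightarrow> bool" where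
  "is_direct_sum S \<longleftrightarrow>
     (\<forall>i. subspace (S i)) \<and> (\<forall>u. \<exists>!s. (\<forall>i. s i \<in> S i) \<and> u = (\<Sum>i\<in>UNIV. s i))"

definition prod_space :: "('p::finite \<Rightarrow> 'v set) \<Rightarrow> ('v, 'p) vec set" where
  "prod_space V = {v. \<forall>i. v $ i \<in> V i}"

definition restrict_all :: "('p::finite \<Rightarrow> 'u \<Rightarrow> 'v) \<Rightarrow> 'u \<Rightarrow> ('v, 'p) vec" where
  "restrict_all R u = (\<chi> i. R i u)"

definition assemble ::
    "('p::finite \<Rightarrow> 'u::real_inner \<Rightarrow> 'v::real_inner) \<Rightarrow> ('v, 'p) vec \<Rightarrow> 'u" where
  "assemble R v = (\<Sum>i\<in>UNIV. adjoint (R i) (v $ i))"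

definition block_op ::
    "('p \<Rightarrow> 'p \<Rightarrow> 'v \<Rightarrow> 'v) \<Rightarrow> ('v::real_vector, 'p::finite) vec \<Rightarrow> ('v, 'p) vec" where
  "block_op M v = (\<chi> i. \<Sum>j\<in>UNIV. M i j (v $ j))"

definition entry ::
    "('u::real_inner \<Rightarrow> 'u) \<Rightarrow> ('p \<Rightarrow> 'u \<Rightarrow> 'v::real_inner) \<Rightarrow> 'p \<Rightarrow> 'p \<Rightarrow> 'v \<Rightarrow> 'v" where
  "entry A R i j v = R i (A (adjoint (R j) v))"

definition B_op ::
    "('u::real_inner \<Rightarrow> 'u) \<Rightarrow> ('p::finite \<Rightarrow> 'u \<Rightarrow> 'v::real_inner)
      \<Rightarrow> ('v, 'p) vec \<Rightarrow> ('v, 'p) vec" where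
  "B_op A R = block_op (entry A R)"

definition B1_op ::
    "('u::real_inner \<Rightarrow> 'u) \<Rightarrow> ('p::{finite, linorder} \<Rightarrow> 'u \<Rightarrow> 'v::real_inner)
      \<Rightarrow> ('v, 'p) vec \<Rightarrow> ('v, 'p) vec" where
  "B1_op A R = block_op (\<lambda>i j v.
     if i > j then entry A R i j v else if i = j then (1/2) *\<^sub>R entry A R i i v else 0)"

definition B2_op ::
    "('u::real_inner \<Rightarrow> 'u) \<Rightarrow> ('p::{finite, linorder} \<Rightarrow> 'u \<Rightarrow> 'v::real_inner)
      \<Rightarrow> ('v, 'p) vec \<Rightarrow> ('v, 'p) vec" where
  "B2_op A R = block_op (\<lambda>i j v.
     if i < j then entry A R i j v else if i = j then (1/2) *\<^sub>R entry A R i i v else 0)"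

definition id_plus :: "real \<Rightarrow> ('a::real_vector \<Rightarrow> 'a) \<Rightarrow> 'a \<Rightarrow> 'a" where
  "id_plus c L v = v + c *\<^sub>R L v"

lemma B_op_split:
  fixes A :: "'u::real_inner \<Rightarrow> 'u" and R :: "'p::{finite, linorder} \<Rightarrow> 'u \<Rightarrow> 'v::real_inner"
  shows "B_op A R v = B1_op A R v + B2_op A R v"
proof -
  have half: "x = (1/2) *\<^sub>R x + (1/2) *\<^sub>R x" for x :: 'v
    by (simp flip: scaleR_add_left)
  show ?thesis
    unfolding B_op_def B1_op_def B2_op_def block_op_def vec_eq_iff
    by (auto simp flip: sum.distrib intro!: sum.cong half)
qed

lemma adjoint_fin_dim:
  fixes L :: "'u::real_inner \<Rightarrow> 'v::real_inner"
  assumes "fin_dim_subspace (UNIV :: 'u set)" and L: "linear L"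
  shows "L u \<bullet> v = u \<bullet> adjoint L v"
proof -
  obtain C :: "'u set" where C: "finite C" "span C = UNIV" "pairwise orthogonal C"
    using assms(1) basis_orthogonal unfolding fin_dim_subspace_def by metis
  define g where "g v = (\<Sum>c\<in>C. (L c \<bullet> v / (c \<bullet> c)) *\<^sub>R c)" for v
  have basis: "L c \<bullet> v = c \<bullet> g v" if "c \<in> C" for c v
  proof -
    have "c \<bullet> g v = (\<Sum>d\<in>C. if d = c then L c \<bullet> v else 0)"
      unfolding g_def inner_sum_right
    proof (rule sum.cong)
      fix d assume "d \<in> C"
      then show "c \<bullet> ((L d \<bullet> v / (d \<bullet> d)) *\<^sub>R d) = (if d = c then L c \<bullet> v else 0)"
        using C(3) that linear_0[OF L] by (auto simp: pairwise_def orthogonal_def)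
    qed simp
    then show ?thesis using that C(1) by simp
  qed
  have "L u \<bullet> v = u \<bullet> g v" for u v
  proof -
    have "u \<in> span C" using C(2) by simp
    then show ?thesis
      by (induction rule: span_induct_alt)
        (simp_all add: linear_0[OF L] linear_add[OF L] linear_scale[OF L] inner_add_left basis)
  qed
  then have "\<forall>x y. L x \<bullet> y = x \<bullet> g y" by blast
  then have "\<forall>x y. L x \<bullet> y = x \<bullet> adjoint L y"
    unfolding adjoint_def by (rule someI[where P = "\<lambda>h. \<forall>x y. L x \<bullet> y = x \<bullet> h y"])
  then show ?thesis by blast
qed

lemma adjoint_B1_op:
  fixes A :: "'u::real_inner \<Rightarrow> 'u" and R :: "'p::{finite, linorder} \<Rightarrow> 'u \<Rightarrow> 'v::real_inner"
  assumes fin: "fin_dim_subspace (UNIV :: 'u set)" and A: "self_adjoint_pos_def A"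
    and R: "\<And>i. linear (R i)"
  shows "adjoint (B1_op A R) = B2_op A R"
proof (rule adjoint_unique, intro allI)
  fix v z
  have entry: "entry A R i j a \<bullet> b = a \<bullet> entry A R j i b" for i j a b
    using A adjoint_fin_dim[OF fin R] adjoint_fin_dim[OF fin, of A]
    unfolding entry_def self_adjoint_pos_def_def by (metis inner_commute)
  have "B1_op A R v \<bullet> z = (\<Sum>i\<in>UNIV. \<Sum>j\<in>UNIV.
      (if i > j then entry A R i j (v $ j) else if i = j then (1/2) *\<^sub>R entry A R i i (v $ j) else 0)
        \<bullet> z $ i)"
    by (simp add: B1_op_def block_op_def inner_vec_def inner_sum_left)
  also have "\<dots> = (\<Sum>j\<in>UNIV. \<Sum>i\<in>UNIV. v $ j \<bullet>
      (if j < i then entry A R j i (z $ i) else if j = i then (1/2) *\<^sub>R entry A R j j (z $ i) else 0))"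
    by (subst sum.swap) (auto intro!: sum.cong simp: entry)
  also have "\<dots> = v \<bullet> B2_op A R z"
    by (simp add: B2_op_def block_op_def inner_vec_def inner_sum_right)
  finally show "B1_op A R v \<bullet> z = v \<bullet> B2_op A R z" .
qed

end

theory Submission
  imports Defs
begin

text \<open>
  Test the scheme with the difference quotient $d = (w^{n+1} - w^n)/\tau$. Since $B_1^* = B_2$, the
  factorized operator contributes
  $\|d\|^2 + \tau\sigma (Bd,d) + \tau^2\sigma^2 \|B_2 d\|^2$, and writing
  $w^n = \frac12 (w^{n+1} + w^n) - \frac{\tau}{2} d$ turns $(Bw^n, d)$ into a telescoping difference
  of energies minus $\frac{\tau}{2} (Bd,d)$, which is absorbed because $\sigma \ge \frac12$. The
  right-hand side satisfies $(f,d) \le \|d\|^2 + \frac14 \|f\|^2$. Finally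
  $(Bw,w) = (Ay,y)$ for $y = \sum_i R_i^* w_i$, and restricting $f$ to the components is isometric.
\<close>

lemma linear_adjoint_fin_dim:
  fixes L :: "'u::real_inner \<Rightarrow> 'v::real_inner"
  assumes "fin_dim_subspace (UNIV :: 'u set)" "linear L"
  shows "linear (adjoint L)"
  \<comment> \<open>Equality is tested against every vector, where the adjoint can be traded back
    for \<open>L\<close>.\<close>
  by (rule linearI; rule vector_eq_ldot[THEN iffD1])
    (simp_all add: inner_add_right flip: adjoint_fin_dim[OF assms])

lemma linear_assemble:
  fixes R :: "'p::finite \<Rightarrow> 'u::real_inner \<Rightarrow> 'v::real_inner"
  assumes "fin_dim_subspace (UNIV :: 'u set)" "\<And>i. linear (R i)"
  shows "linear (assemble R)"
  using linear_adjoint_fin_dim[OF assms]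
  by (intro linearI)
    (simp_all add: assemble_def linear_add linear_scale sum.distrib scaleR_sum_right)

text \<open>Shows that \<open>assemble R\<close> acts as the adjoint of
  \<open>restrict_all R\<close>. Where it is also a left inverse, \<open>restrict_all R\<close>
  preserves norms.\<close>

lemma inner_restrict_all:
  fixes R :: "'p::finite \<Rightarrow> 'u::real_inner \<Rightarrow> 'v::real_inner"
  assumes "fin_dim_subspace (UNIV :: 'u set)" "\<And>i. linear (R i)"
  shows "restrict_all R u \<bullet> v = u \<bullet> assemble R v"
  by (simp add: restrict_all_def assemble_def inner_vec_def inner_sum_right adjoint_fin_dim[OF assms])

text \<open>By linearity the block sums collapse, so the quadratic form of \<open>B_op A R\<close>
  becomes the energy of the assembled vector.\<close>

lemma B_op_eq_restrict_assemble:
  fixes R :: "'p::finite \<Rightarrow> 'u::real_inner \<Rightarrow> 'v::real_inner"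
  assumes "linear A" "\<And>i. linear (R i)"
  shows "B_op A R v = restrict_all R (A (assemble R v))"
  by (simp add: B_op_def block_op_def entry_def restrict_all_def assemble_def
      linear_sum[OF assms(1)] linear_sum[OF assms(2)])

text \<open>This does not follow from \<open>adjoint_B1_op\<close>: without finite dimension of the ambient
  space, \<open>adjoint\<close> is an unspecified function when no true adjoint exists.\<close>

lemma inner_B1_op:
  fixes A :: "'u::real_inner \<Rightarrow> 'u" and R :: "'p::{finite, linorder} \<Rightarrow> 'u \<Rightarrow> 'v::real_inner"
  assumes fin: "fin_dim_subspace (UNIV :: 'u set)" and A: "self_adjoint_pos_def A"
    and R: "\<And>i. linear (R i)"
  shows "B1_op A R v \<bullet> z = v \<bullet> B2_op A R z"
proof -
  \<comment> \<open>Self-adjointness of \<open>A\<close> makes transposed entries mutually adjoint;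
    exchanging the two sums then turns the lower triangle into the upper one.\<close>
  have entry: "entry A R i j a \<bullet> b = a \<bullet> entry A R j i b" for i j a b
    using A adjoint_fin_dim[OF fin R] adjoint_fin_dim[OF fin, of A]
    unfolding entry_def self_adjoint_pos_def_def by (metis inner_commute)
  show ?thesis
    unfolding B1_op_def B2_op_def block_op_def inner_vec_def
    by (simp add: inner_sum_left inner_sum_right, subst sum.swap)
      (auto intro!: sum.cong simp: entry)
qed

lemma energy_norm_sq:
  assumes "self_adjoint_pos_def A"
  shows "(energy_norm A u)\<^sup>2 = A u \<bullet> u"
proof -
  have "A u \<bullet> u \<ge> 0"
    using assms by (cases "u = 0") (auto simp: self_adjoint_pos_def_def less_imp_le)
  then show ?thesis by (simp add: energy_norm_def)
qed

text \<open>Moving the outer factor to the other argument turns the form into the squared norm of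
  \<open>id_plus c B2 d\<close>. Its cross term is \<open>2 * (B2 d \<bullet> d)\<close>, which is
  the form of \<open>B1 + B2\<close>.\<close>

lemma factorized_inner:
  fixes B1 B2 :: "'a::real_inner \<Rightarrow> 'a"
  assumes "\<And>x z. B1 x \<bullet> z = x \<bullet> B2 z"
  shows "id_plus c B1 (id_plus c B2 d) \<bullet> d = d \<bullet> d + c * ((B1 d + B2 d) \<bullet> d) + c\<^sup>2 * (B2 d \<bullet> B2 d)"
  by (simp add: id_plus_def assms inner_add_left distrib_left power2_eq_square
      inner_commute[of "B2 d" d])

lemma energy_step:
  fixes A :: "'u::real_inner \<Rightarrow> 'u" and R :: "'p::{finite, linorder} \<Rightarrow> 'u \<Rightarrow> 'v::real_inner"
  assumes fin: "fin_dim_subspace (UNIV :: 'u set)" and A: "self_adjoint_pos_def A"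
    and R: "\<And>i. linear (R i)"
    and decomp: "\<And>u. assemble R (restrict_all R u) = u"
    and sigma: "\<sigma> \<ge> 1/2" and tau: "\<tau> > 0"
    and scheme: "id_plus (\<tau> * \<sigma>) (B1_op A R)
        (id_plus (\<tau> * \<sigma>) (B2_op A R) ((1 / \<tau>) *\<^sub>R (w' - w)))
      + B_op A R w = restrict_all R g"
  shows "(energy_norm A (assemble R w'))\<^sup>2
    \<le> (energy_norm A (assemble R w))\<^sup>2 + 1/2 * (\<tau> * (norm g)\<^sup>2)"
proof -
  have linA: "linear A" and selfA: "adjoint A = A"
    using A by (simp_all add: self_adjoint_pos_def_def)
  define d where "d = (1 / \<tau>) *\<^sub>R (w' - w)"
  define a b where "a = assemble R w" and "b = assemble R d"
  let ?e = "\<lambda>u. A u \<bullet> u"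
  have lin: "linear (assemble R)" using fin R by (rule linear_assemble)
  have w': "w' = w + \<tau> *\<^sub>R d" using tau by (simp add: d_def)
  have aw': "assemble R w' = a + \<tau> *\<^sub>R b"
    by (simp add: w' a_def b_def linear_add[OF lin] linear_scale[OF lin])
  have innerB: "B_op A R v \<bullet> z = A (assemble R v) \<bullet> assemble R z" for v z
    by (simp add: B_op_eq_restrict_assemble[OF linA R] inner_restrict_all[OF fin R])
  have sym: "A x \<bullet> z = A z \<bullet> x" for x z
    using adjoint_fin_dim[OF fin linA, of x z] selfA by (simp add: inner_commute)
  have "restrict_all R g \<bullet> d = d \<bullet> d + \<tau> * \<sigma> * ?e b
      + (\<tau> * \<sigma>)\<^sup>2 * (B2_op A R d \<bullet> B2_op A R d) + A a \<bullet> b"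
    by (simp add: scheme[folded d_def, symmetric] inner_add_left[of _ "B_op A R w"]
        factorized_inner[OF inner_B1_op[OF fin A R]] innerB a_def b_def flip: B_op_split)
  moreover have "\<tau> * \<sigma> * ?e b \<ge> \<tau> / 2 * ?e b"
    using sigma tau energy_norm_sq[OF A, of b]
    by (intro mult_right_mono) (auto simp flip: energy_norm_sq[OF A])
  moreover have "(\<tau> * \<sigma>)\<^sup>2 * (B2_op A R d \<bullet> B2_op A R d) \<ge> 0" by simp
  moreover have "restrict_all R g \<bullet> d \<le> d \<bullet> d + (norm g)\<^sup>2 / 4"
  proof -
    have iso: "restrict_all R g \<bullet> restrict_all R g = (norm g)\<^sup>2"
      by (simp add: inner_restrict_all[OF fin R] decomp power2_norm_eq_inner)
    \<comment> \<open>Completing the square with one half of the right-hand side gives the constant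
      1/4.\<close>
    have "0 \<le> (d - (1/2) *\<^sub>R restrict_all R g) \<bullet> (d - (1/2) *\<^sub>R restrict_all R g)" by simp
    then show ?thesis
      by (simp add: inner_diff_left inner_diff_right iso inner_commute[of d "restrict_all R g"])
  qed
  ultimately have "A a \<bullet> b + \<tau> / 2 * ?e b \<le> (norm g)\<^sup>2 / 4" by linarith
  \<comment> \<open>The bounded quantity is the energy increment divided by
    \<open>2 * \<tau>\<close>; this factor turns 1/4 into the final 1/2.\<close>
  then have "2 * \<tau> * (A a \<bullet> b + \<tau> / 2 * ?e b) \<le> 2 * \<tau> * ((norm g)\<^sup>2 / 4)"
    using tau by (intro mult_left_mono) auto
  moreover have "?e (a + \<tau> *\<^sub>R b) = ?e a + 2 * \<tau> * (A a \<bullet> b + \<tau> / 2 * ?e b)"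
    by (simp add: linear_add[OF linA] linear_scale[OF linA] inner_add_left inner_add_right
        sym[of b a] algebra_simps)
  ultimately show ?thesis
    unfolding energy_norm_sq[OF A] aw' by (simp add: a_def)
qed

theorem theorem4:
  fixes A :: "'u::real_inner \<Rightarrow> 'u"
    and V :: "'p::{finite, linorder} \<Rightarrow> 'v::real_inner set"
    and R :: "'p \<Rightarrow> 'u \<Rightarrow> 'v"
    and f :: "real \<Rightarrow> 'u" and u0 :: 'u
    and T \<tau> \<sigma> :: real and N :: nat
    and w :: "nat \<Rightarrow> ('v, 'p) vec" and y :: "nat \<Rightarrow> 'u"
  assumes U_fin: "fin_dim_subspace (UNIV :: 'u set)"
    and V_fin: "\<And>i. fin_dim_subspace (V i)"
    and A: "self_adjoint_pos_def A"
    and R_lin: "\<And>i. linear (R i)"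
    and R_into: "\<And>i u. R i u \<in> V i"
    and U_sum: "is_direct_sum (\<lambda>i. adjoint (R i) ` V i)"
    and U_decomp: "\<And>u. u = (\<Sum>i\<in>UNIV. adjoint (R i) (R i u))"
    and R_same: "\<And>i v. v \<in> V i \<Longrightarrow> R i (adjoint (R i) v) = v"
    and R_diff: "\<And>i j v. i \<noteq> j \<Longrightarrow> v \<in> V j \<Longrightarrow> R i (adjoint (R j) v) = 0"
    and sigma: "\<sigma> \<ge> 1/2"
    and tau: "\<tau> > 0" and T: "T > 0" and grid: "real N * \<tau> = T"
    and w_in: "\<And>n. n \<le> N \<Longrightarrow> w n \<in> prod_space V"
    and w_init: "w 0 = restrict_all R u0"
    and scheme: "\<And>n. n < N \<Longrightarrow>
      id_plus (\<tau> * \<sigma>) (B1_op A R)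
        (id_plus (\<tau> * \<sigma>) (B2_op A R) ((1 / \<tau>) *\<^sub>R (w (Suc n) - w n)))
      + B_op A R (w n) = restrict_all R (f (real n * \<tau>))"
    and y: "\<And>n. n \<le> N \<Longrightarrow> y n = assemble R (w n)"
  shows "\<forall>n<N. (energy_norm A (y (Suc n)))\<^sup>2
      \<le> (energy_norm A u0)\<^sup>2 + 1/2 * (\<Sum>k=0..n. \<tau> * (norm (f (real k * \<tau>)))\<^sup>2)"
proof -
  have decomp: "assemble R (restrict_all R u) = u" for u
    using U_decomp[of u] by (simp add: assemble_def restrict_all_def)
  have step: "(energy_norm A (y (Suc n)))\<^sup>2
      \<le> (energy_norm A (y n))\<^sup>2 + 1/2 * (\<tau> * (norm (f (real n * \<tau>)))\<^sup>2)" if "n < N" for n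
    using energy_step[OF U_fin A R_lin decomp sigma tau scheme[OF that]] y that by simp
  have "n < N \<Longrightarrow> (energy_norm A (y (Suc n)))\<^sup>2
      \<le> (energy_norm A u0)\<^sup>2 + 1/2 * (\<Sum>k=0..n. \<tau> * (norm (f (real k * \<tau>)))\<^sup>2)" for n
  proof (induction n)
    case 0
    \<comment> \<open>The initial data assemble exactly to \<open>u0\<close>, so the first step
      starts from its energy.\<close>
    then show ?case using step[of 0] y[of 0] w_init decomp by simp
  next
    case (Suc n)
    then show ?case using step[of "Suc n"] by (simp add: distrib_left)
  qed
  then show ?thesis by blast
qed

end
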